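(* Let $d_1,d_2\ge1$ and let $\alpha\in\mathbb{R}^{d_2}$ with $\alpha_i>0$ for all $i$ and $\sum_{i=1}^{d_2}\alpha_i=1$. Let $\varphi(w)=\prod_{i=1}^{d_2}w_i^{2\alpha_i}$, let $\mathcal{K}_{\mathrm{rpower}}=\{(u,w)\in\mathbb{R}^{d_1}\times\mathbb{R}^{d_2}_+:\|u\|\le\sqrt{\varphi(w)}\}$, and let $g$ and $H$ be the gradient and Hessian of the barrier $f(u,w)=-\log(\varphi(w)-\|u\|^2)-\sum_{i=1}^{d_2}(1-\alpha_i)\log(w_i)$ on $\operatorname{int}(\mathcal{K}_{\mathrm{rpower}})$. For every $\tilde u=(u,w)\in\operatorname{int}(\mathcal{K}_{\mathrm{rpower}})$ and every direction $\tilde x=(x,z)\in\mathbb{R}^{d_1}\times\mathbb{R}^{d_2}$, $$(H(\tilde u)^{-1}\tilde x)_{u_i}=\frac{\zeta x_i}{2}+\frac{u_i}{k_3}\Bigl(\frac{-\zeta k_3-2k_2\varphi(w)}{k_1}\langle x,u\rangle-\Bigl\langle\frac{\alpha}{g_w},z\Bigr\rangle\Bigr)\quad(i=1,\dots,d_1),$$ $$(H(\tilde u)^{-1}\tilde x)_{w_i}=-\frac{w_iz_i}{g_{w_i}}-\frac{\alpha_i}{k_3g_{w_i}}\Bigl(\langle x,u\rangle-\frac{2\|u\|^2}{\zeta}\Bigl\langle\frac{\alpha}{g_w},z\Bigr\rangle\Bigr)\quad(i=1,\dots,d_2),$$ where $\zeta=\varphi(w)-\|u\|^2$ and $$k_1=\varphi(w)+\|u\|^2,\qquad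 k_2=\Bigl\langle\frac{\alpha}{w},\frac{\alpha}{g_w}\Bigr\rangle,\qquad k_3=\frac{k_1}{2\varphi(w)}+2k_2\frac{\|u\|^2}{\zeta}.$$
   Context: Multiplication and division of vectors are componentwise, so e.g. $\frac{\alpha}{g_w}$ is the vector in $\mathbb{R}^{d_2}$ with entries $\alpha_i/g_{w_i}$. $\langle\cdot,\cdot\rangle$ is the standard inner product and $\|\cdot\|$ the Euclidean norm. Subscripts $u_i$, $w_i$ denote the components of a vector in $\mathbb{R}^{d_1}\times\mathbb{R}^{d_2}$ corresponding to the coordinates $u_i$ and $w_i$; $g_w=(g_{w_1},\dots,g_{w_{d_2}})$ is the partial gradient of $f$ with respect to $w$ at $\tilde u$, i.e. $g_{w_i}=-\frac{2\alpha_i\varphi(w)}{w_i\zeta}-\frac{1-\alpha_i}{w_i}$. *)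

theory Defs
  imports "HOL-Analysis.Analysis"
begin

definition vec_divide :: "real ^ 'n \<Rightarrow> real ^ 'n \<Rightarrow> real ^ 'n" (infixl "\<oslash>" 70)
  where "a \<oslash> b = (\<chi> i. a $ i / b $ i)"

definition gradient :: "('a::real_inner \<Rightarrow> real) \<Rightarrow> 'a \<Rightarrow> 'a"
  where "gradient f x = (THE D. GDERIV f x :> D)"

text \<open>The Hessian at a point is taken as a linear operator: the derivative of the gradient.
  Its inverse matrix corresponds to \<^term>\<open>inv (hessian f x)\<close> when the operator is bijective.\<close>

definition hessian :: "('a::real_inner \<Rightarrow> real) \<Rightarrow> 'a \<Rightarrow> 'a \<Rightarrow> 'a"
  where "hessian f x = frechet_derivative (gradient f) (at x)"

definition \<phi> :: "real ^ 'n \<Rightarrow> real ^ 'n \<Rightarrow> real"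
  where "\<phi> \<alpha> w = (\<Prod>i\<in>UNIV. w $ i powr (2 * \<alpha> $ i))"

text \<open>The factor \<open>w\<close> ranges over the closed nonnegative orthant; taking the open orthant instead
  does not change the interior of the cone.\<close>

definition rpower_cone :: "real ^ 'n \<Rightarrow> ((real ^ 'm) \<times> (real ^ 'n)) set"
  where "rpower_cone \<alpha> = {(u, w). (\<forall>i. 0 \<le> w $ i) \<and> norm u \<le> sqrt (\<phi> \<alpha> w)}"

text \<open>Only the values on the interior of \<^term>\<open>rpower_cone \<alpha>\<close> are meaningful, where all arguments
  of \<^const>\<open>ln\<close> are positive.\<close>

definition rpower_barrier :: "real ^ 'n \<Rightarrow> (real ^ 'm) \<times> (real ^ 'n) \<Rightarrow> real"
  where "rpower_barrier \<alpha> = (\<lambda>(u, w).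
    - ln (\<phi> \<alpha> w - (norm u)\<^sup>2) - (\<Sum>i\<in>UNIV. (1 - \<alpha> $ i) * ln (w $ i)))"

end

theory Submission
  imports Defs
begin

text \<open>
  Write \<open>\<zeta> = \<phi>(w) - \<parallel>u\<parallel>\<^sup>2\<close>. On the interior of the cone all \<open>w\<^sub>i\<close> and \<open>\<zeta>\<close> are positive, so
  gradient and Hessian can be computed in closed form. Applied to a direction \<open>(a, b)\<close>, the
  Hessian is a multiple of the identity on \<open>a\<close> and a diagonal matrix on \<open>b\<close>, up to terms that
  depend on the direction only through the two numbers \<open>p = \<langle>u, a\<rangle>\<close> and \<open>s = \<langle>\<alpha>/w, b\<rangle>\<close>
  (\<open>barrier_hess\<close>). Inverting it therefore comes down to a linear system for \<open>p\<close> and \<open>s\<close>. With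
  \<open>n = \<parallel>u\<parallel>\<^sup>2\<close>, \<open>X = \<langle>x, u\<rangle>\<close>, \<open>q = \<langle>\<alpha>/g\<^sub>w, z\<rangle>\<close> and \<open>t = 4\<phi>(w)(p - sn)/\<zeta>\<^sup>2\<close>, pairing the
  \<open>u\<close>-equations with \<open>u\<close> and the solved \<open>w\<close>-equations with \<open>\<alpha>/w\<close> leaves
  \<open>k\<^sub>1 t / (2\<phi>(w)) = X + 2ns/\<zeta>\<close> and \<open>s = -q - k\<^sub>2 t\<close>, hence \<open>k\<^sub>3 t = X - 2nq/\<zeta>\<close>.
  Substituting \<open>t\<close> and \<open>s\<close> back gives the stated formulas; lemma \<open>reduced_hessian_system\<close>
  holds the scalar computation.

  The point that needs an inequality is \<open>k\<^sub>3 > 0\<close> (\<open>reduced_pivot_pos\<close>), because \<open>k\<^sub>2\<close> is negative.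
  Since \<open>-w\<^sub>i g\<^sub>w\<^sub>i = 2\<alpha>\<^sub>i\<phi>(w)/\<zeta> + (1 - \<alpha>\<^sub>i) \<ge> 2\<alpha>\<^sub>i\<phi>(w)/\<zeta>\<close> and the weights sum to 1,
  \<open>k\<^sub>2 \<ge> -\<zeta>/(2\<phi>(w))\<close>, and this yields \<open>k\<^sub>3 \<ge> \<zeta>/(2\<phi>(w)) > 0\<close>.

  The formulas thus define a right inverse of the Hessian. A surjective linear endomorphism of a
  finite-dimensional space is bijective, so this right inverse is the inverse.
\<close>

section \<open>Closed forms for the derivatives\<close>

definition slack :: "real ^ 'n \<Rightarrow> (real ^ 'm) \<times> (real ^ 'n) \<Rightarrow> real"
  where "slack \<alpha> y = \<phi> \<alpha> (snd y) - (norm (fst y))\<^sup>2"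

definition barrier_grad :: "real ^ 'n \<Rightarrow> (real ^ 'm) \<times> (real ^ 'n) \<Rightarrow> (real ^ 'm) \<times> (real ^ 'n)"
  where "barrier_grad \<alpha> y =
    ((2 / slack \<alpha> y) *\<^sub>R fst y,
     \<chi> i. - (2 * \<alpha> $ i * (\<phi> \<alpha> (snd y) / slack \<alpha> y) + (1 - \<alpha> $ i)) / snd y $ i)"

text \<open>
  The derivative of \<^term>\<open>barrier_grad \<alpha>\<close>, arranged so that everything except a scalar multiple of
  the identity and a diagonal matrix depends on the direction only through \<open>s\<close> and \<open>p\<close>. In the
  second component, the first summand comes from differentiating \<open>\<phi>/\<zeta>\<close> and the second one from
  differentiating \<open>1/w\<^sub>i\<close>.
\<close>

definition barrier_hess ::
    "real ^ 'n \<Rightarrow> (real ^ 'm) \<times> (real ^ 'n) \<Rightarrow> (real ^ 'm) \<times> (real ^ 'n) \<Rightarrow> (real ^ 'm) \<times> (real ^ 'n)"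
  where "barrier_hess \<alpha> y h =
    (let u = fst y; w = snd y; s = (\<alpha> \<oslash> w) \<bullet> snd h; p = u \<bullet> fst h; \<zeta> = slack \<alpha> y
     in ((2 / \<zeta>) *\<^sub>R fst h - ((4 * \<phi> \<alpha> w * s - 4 * p) / \<zeta>\<^sup>2) *\<^sub>R u,
         \<chi> i. - (4 * \<alpha> $ i * \<phi> \<alpha> w * (p - s * (norm u)\<^sup>2) / \<zeta>\<^sup>2) / w $ i
               - snd (barrier_grad \<alpha> y) $ i * snd h $ i / w $ i))"

section \<open>The interior of the cone\<close>

text \<open>
  A small ball around the point stays in the cone. Decreasing a single \<open>w\<^sub>i\<close> inside it must keep
  \<open>w\<^sub>i\<close> nonnegative, and lengthening \<open>u\<close> inside it must keep the norm bound; both original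
  inequalities are therefore strict. For \<open>u = 0\<close>, where there is nothing to lengthen, the second
  one follows from \<open>\<phi> > 0\<close>.
\<close>

lemma interior_rpower_cone:
  fixes u :: "real ^ 'm" and w :: "real ^ 'n"
  assumes "(u, w) \<in> interior (rpower_cone \<alpha>)"
  shows "w $ i > 0" and "(norm u)\<^sup>2 < \<phi> \<alpha> w"
proof -
  obtain e where e: "e > 0" and sub: "ball (u, w) e \<subseteq> rpower_cone \<alpha>"
    using assms mem_interior by blast
  have pos: "w $ i > 0" for i
  proof -
    have "dist (u, w) (u, w - (e/2) *\<^sub>R axis i 1) < e"
      using e by (simp add: dist_Pair_Pair dist_norm)
    then have "(u, w - (e/2) *\<^sub>R axis i 1) \<in> rpower_cone \<alpha>"
      using sub by (auto simp: mem_ball)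
    then have "0 \<le> (w - (e/2) *\<^sub>R axis i 1) $ i"
      unfolding rpower_cone_def by blast
    then show ?thesis using e by (simp add: axis_def)
  qed
  then show "w $ i > 0" .
  have \<phi>: "\<phi> \<alpha> w > 0"
    unfolding \<phi>_def using pos by (intro prod_pos) (simp add: less_imp_neq[OF pos, THEN not_sym])
  show "(norm u)\<^sup>2 < \<phi> \<alpha> w"
  proof (cases "u = 0")
    case False
    have "dist (u, w) (u + (e/2) *\<^sub>R sgn u, w) < e"
      using e False by (simp add: dist_Pair_Pair dist_norm norm_sgn)
    then have "(u + (e/2) *\<^sub>R sgn u, w) \<in> rpower_cone \<alpha>"
      using sub by (auto simp: mem_ball)
    then have "norm (u + (e/2) *\<^sub>R sgn u) \<le> sqrt (\<phi> \<alpha> w)"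
      by (auto simp: rpower_cone_def)
    moreover have "u + (e/2) *\<^sub>R sgn u = (norm u + e/2) *\<^sub>R sgn u"
      using False by (simp add: algebra_simps sgn_div_norm)
    ultimately have "norm u < sqrt (\<phi> \<alpha> w)"
      using e False by (simp add: norm_sgn)
    then show ?thesis
      using \<phi> power_strict_mono[of "norm u" "sqrt (\<phi> \<alpha> w)" 2] by simp
  qed (use \<phi> in simp)
qed

section \<open>Gradient and Hessian of the barrier\<close>

lemma has_derivative_vec_lambda:
  fixes f :: "'n::finite \<Rightarrow> 'a::real_normed_vector \<Rightarrow> real"
  assumes "\<And>i. (f i has_derivative f' i) (at x within S)"
  shows "((\<lambda>y. \<chi> i. f i y) has_derivative (\<lambda>h. \<chi> i. f' i h)) (at x within S)"
proof (subst has_derivative_componentwise_within, rule ballI)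
  fix b :: "real ^ 'n" assume "b \<in> Basis"
  then obtain i where "b = axis i 1" by (auto simp: Basis_vec_def)
  then show "((\<lambda>y. (\<chi> i. f i y) \<bullet> b) has_derivative (\<lambda>h. (\<chi> i. f' i h) \<bullet> b)) (at x within S)"
    using assms[of i] by (simp add: inner_axis)
qed

lemmas has_derivative_vec_nth = bounded_linear.has_derivative[OF bounded_linear_vec_nth]

text \<open>
  On the open positive orthant, \<open>\<phi>\<close> is the exponential of \<open>\<Sum>\<^sub>i 2\<alpha>\<^sub>i ln w\<^sub>i\<close>, which turns
  the product into a sum before differentiating.
\<close>

lemma has_derivative_\<phi>:
  fixes w \<alpha> :: "real ^ 'n"
  assumes pos: "\<And>i. w $ i > 0"
  shows "(\<phi> \<alpha> has_derivative (\<lambda>b. 2 * \<phi> \<alpha> w * ((\<alpha> \<oslash> w) \<bullet> b))) (at w)"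
proof -
  let ?E = "\<lambda>w :: real ^ 'n. exp (\<Sum>i\<in>UNIV. 2 * \<alpha> $ i * ln (w $ i))"
  let ?S = "\<Inter>i. {w :: real ^ 'n. w $ i > 0}"
  have open_S: "open ?S"
    by (intro open_INT finite ballI open_Collect_less continuous_intros)
  have eq: "?E v = \<phi> \<alpha> v" if "v \<in> ?S" for v
    using that by (simp add: \<phi>_def powr_def exp_sum less_imp_neq[THEN not_sym])
  have "(?E has_derivative (\<lambda>b. ?E w * (\<Sum>i\<in>UNIV. 2 * \<alpha> $ i * (b $ i / w $ i)))) (at w)"
    using pos by (auto intro!: derivative_eq_intros has_derivative_vec_nth simp: less_imp_neq[THEN not_sym] divide_inverse ac_simps)
  moreover have "w \<in> ?S" using pos by simp
  ultimately have "(\<phi> \<alpha> has_derivative (\<lambda>b. ?E w * (\<Sum>i\<in>UNIV. 2 * \<alpha> $ i * (b $ i / w $ i)))) (at w)"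
    using has_derivative_transform_within_open[OF _ open_S, of ?E _ w UNIV "\<phi> \<alpha>"] eq by simp
  then show ?thesis
    using eq[OF \<open>w \<in> ?S\<close>]
    by (simp add: inner_vec_def vec_divide_def sum_distrib_left mult_ac)
qed

lemma has_derivative_\<phi>_snd:
  fixes y :: "(real ^ 'm) \<times> (real ^ 'n)"
  assumes "\<And>i. snd y $ i > 0"
  shows "((\<lambda>y. \<phi> \<alpha> (snd y)) has_derivative (\<lambda>h. 2 * \<phi> \<alpha> (snd y) * ((\<alpha> \<oslash> snd y) \<bullet> snd h))) (at y)"
proof (rule has_derivative_compose[where f = snd and g = "\<phi> \<alpha>"])
  show "(snd has_derivative snd) (at y)"
    by (rule bounded_linear_imp_has_derivative[OF bounded_linear_snd])
  show "(\<phi> \<alpha> has_derivative (\<lambda>b. 2 * \<phi> \<alpha> (snd y) * ((\<alpha> \<oslash> snd y) \<bullet> b))) (at (snd y))"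
    using assms by (rule has_derivative_\<phi>)
qed

lemma has_derivative_slack:
  fixes y :: "(real ^ 'm) \<times> (real ^ 'n)"
  assumes "\<And>i. snd y $ i > 0"
  shows "(slack \<alpha> has_derivative
           (\<lambda>h. 2 * \<phi> \<alpha> (snd y) * ((\<alpha> \<oslash> snd y) \<bullet> snd h) - 2 * (fst y \<bullet> fst h))) (at y)"
  unfolding slack_def power2_norm_eq_inner
  by (rule has_derivative_eq_rhs, rule has_derivative_diff[OF has_derivative_\<phi>_snd[OF assms]
        has_derivative_inner[OF has_derivative_fst[OF has_derivative_ident]
          has_derivative_fst[OF has_derivative_ident]]])
     (simp add: inner_commute)

lemma GDERIV_rpower_barrier:
  fixes y :: "(real ^ 'm) \<times> (real ^ 'n)"
  assumes pos: "\<And>i. snd y $ i > 0" and slack: "slack \<alpha> y > 0"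
  shows "GDERIV (rpower_barrier \<alpha>) y :> barrier_grad \<alpha> y"
proof -
  let ?D = "\<lambda>h. 2 * \<phi> \<alpha> (snd y) * ((\<alpha> \<oslash> snd y) \<bullet> snd h) - 2 * (fst y \<bullet> fst h)"
  have "((\<lambda>y. - ln (slack \<alpha> y) - (\<Sum>i\<in>UNIV. (1 - \<alpha> $ i) * ln (snd y $ i))) has_derivative
      (\<lambda>h. - (?D h / slack \<alpha> y) - (\<Sum>i\<in>UNIV. (1 - \<alpha> $ i) * (snd h $ i / snd y $ i)))) (at y)"
    using pos slack
    by (auto intro!: derivative_eq_intros has_derivative_vec_nth has_derivative_slack simp: divide_inverse mult_ac)
  moreover have "- (?D h / slack \<alpha> y) - (\<Sum>i\<in>UNIV. (1 - \<alpha> $ i) * (snd h $ i / snd y $ i))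
      = h \<bullet> barrier_grad \<alpha> y" for h
  proof -
    have "snd h \<bullet> snd (barrier_grad \<alpha> y)
      = (\<Sum>i\<in>UNIV. - (2 * \<phi> \<alpha> (snd y) / slack \<alpha> y) * (\<alpha> $ i / snd y $ i * snd h $ i)
            - (1 - \<alpha> $ i) * (snd h $ i / snd y $ i))"
      unfolding inner_vec_def
      by (intro sum.cong) (simp_all add: barrier_grad_def add_divide_distrib diff_divide_distrib algebra_simps)
    also have "\<dots> = - (2 * \<phi> \<alpha> (snd y) / slack \<alpha> y) * ((\<alpha> \<oslash> snd y) \<bullet> snd h)
       - (\<Sum>i\<in>UNIV. (1 - \<alpha> $ i) * (snd h $ i / snd y $ i))"
      by (simp only: sum_subtractf sum_distrib_left[symmetric] inner_vec_def vec_divide_def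
            vec_lambda_beta inner_real_def)
    finally show ?thesis
      by (simp add: inner_prod_def barrier_grad_def inner_commute diff_divide_distrib)
  qed
  ultimately show ?thesis
    by (simp add: gderiv_def rpower_barrier_def slack_def case_prod_beta')
qed

lemma gradient_eqI:
  assumes "GDERIV f x :> D"
  shows "gradient f x = D"
  unfolding gradient_def
proof (rule the_equality)
  show "GDERIV f x :> D" by (fact assms)
next
  fix D' assume "GDERIV f x :> D'"
  then have "(\<lambda>h. h \<bullet> D') = (\<lambda>h. h \<bullet> D)"
    using assms unfolding gderiv_def by (rule has_derivative_unique)
  then have "\<forall>h. h \<bullet> D' = h \<bullet> D" by (simp add: fun_eq_iff)
  then show "D' = D" by (simp only: vector_eq_ldot)
qed

lemma has_derivative_barrier_grad:
  fixes y :: "(real ^ 'm) \<times> (real ^ 'n)"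
  assumes pos: "\<And>i. snd y $ i > 0" and slack: "slack \<alpha> y > 0"
  shows "(barrier_grad \<alpha> has_derivative barrier_hess \<alpha> y) (at y)"
proof -
  let ?\<zeta> = "slack \<alpha> y" and ?f = "\<phi> \<alpha> (snd y)" and ?n = "(norm (fst y))\<^sup>2"
  let ?s = "\<lambda>h. (\<alpha> \<oslash> snd y) \<bullet> snd h" and ?p = "\<lambda>h. fst y \<bullet> fst h"
  let ?D = "\<lambda>h :: (real ^ 'm) \<times> (real ^ 'n). 2 * ?f * ?s h - 2 * ?p h"
  let ?R = "\<lambda>h. 2 * ?f / ?\<zeta>\<^sup>2 * (?p h - ?s h * ?n)"
  note D\<zeta> = has_derivative_slack[OF pos]
  have u_part: "((\<lambda>y. (2 / slack \<alpha> y) *\<^sub>R fst y) has_derivative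
      (\<lambda>h. (2 / ?\<zeta>) *\<^sub>R fst h - ((4 * ?f * ?s h - 4 * ?p h) / ?\<zeta>\<^sup>2) *\<^sub>R fst y)) (at y)"
    using slack
    by (auto intro!: derivative_eq_intros D\<zeta> simp: fun_eq_iff vec_eq_iff field_simps power2_eq_square)
  have ratio: "((\<lambda>y. \<phi> \<alpha> (snd y) / slack \<alpha> y) has_derivative ?R) (at y)"
  proof -
    \<comment> \<open>In the quotient rule, the two terms quadratic in \<open>\<phi>\<close> cancel.\<close>
    have "((\<lambda>y. \<phi> \<alpha> (snd y) / slack \<alpha> y) has_derivative
        (\<lambda>h. (2 * ?f * ?s h * ?\<zeta> - ?f * ?D h) / (?\<zeta> * ?\<zeta>))) (at y)"
      using slack by (intro has_derivative_divide'[OF has_derivative_\<phi>_snd[OF pos] D\<zeta>]) simp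
    moreover have "(2 * ?f * ?s h * ?\<zeta> - ?f * ?D h) / (?\<zeta> * ?\<zeta>) = ?R h" for h
    proof -
      have "2 * ?f * ?s h * ?\<zeta> - ?f * ?D h = 2 * ?f * (?p h - ?s h * ?n)"
        unfolding slack_def by (simp add: algebra_simps)
      then show ?thesis by (simp add: power2_eq_square)
    qed
    ultimately show ?thesis by simp
  qed
  have w_part: "((\<lambda>y. - (2 * \<alpha> $ i * (\<phi> \<alpha> (snd y) / slack \<alpha> y) + (1 - \<alpha> $ i)) / snd y $ i) has_derivative
      (\<lambda>h. - (4 * \<alpha> $ i * ?f * (?p h - ?s h * ?n) / ?\<zeta>\<^sup>2) / snd y $ i
        - snd (barrier_grad \<alpha> y) $ i * snd h $ i / snd y $ i)) (at y)" for i
  proof -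
    let ?q = "?f / ?\<zeta>" and ?w = "snd y $ i"
    have num: "((\<lambda>y. - (2 * \<alpha> $ i * (\<phi> \<alpha> (snd y) / slack \<alpha> y) + (1 - \<alpha> $ i)))
        has_derivative (\<lambda>h. - (2 * \<alpha> $ i * ?R h))) (at y)"
      by (rule has_derivative_eq_rhs, rule has_derivative_minus[OF has_derivative_add[OF
            has_derivative_mult_right[OF ratio, of "2 * \<alpha> $ i"] has_derivative_const]]) simp
    have quot: "((\<lambda>y. - (2 * \<alpha> $ i * (\<phi> \<alpha> (snd y) / slack \<alpha> y) + (1 - \<alpha> $ i)) / snd y $ i) has_derivative
      (\<lambda>h. (- (2 * \<alpha> $ i * ?R h) * ?w - - (2 * \<alpha> $ i * ?q + (1 - \<alpha> $ i)) * snd h $ i) / (?w * ?w))) (at y)"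
      using pos[of i]
      by (intro has_derivative_divide'[OF num] has_derivative_vec_nth has_derivative_snd
            has_derivative_ident) simp
    have split: "(- r * v - - g * b) / (v * v) = - r / v - - g / v * b / v" if "v \<noteq> 0" for r v g b :: real
      using that by (simp add: field_simps)
    have "2 * \<alpha> $ i * ?R h = 4 * \<alpha> $ i * ?f * (?p h - ?s h * ?n) / ?\<zeta>\<^sup>2" for h
      by simp
    then show ?thesis
      using quot
      by (simp only: split[of ?w, OF less_imp_neq[OF pos, THEN not_sym]] barrier_grad_def snd_conv
            vec_lambda_beta)
  qed
  show ?thesis
    unfolding barrier_grad_def[abs_def]
    using has_derivative_Pair[OF u_part has_derivative_vec_lambda[OF w_part]]
    unfolding barrier_grad_def barrier_hess_def[abs_def] Let_def .
qed

lemma gradient_rpower_barrier: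
  fixes y :: "(real ^ 'm) \<times> (real ^ 'n)"
  assumes "y \<in> interior (rpower_cone \<alpha>)"
  shows "GDERIV (rpower_barrier \<alpha>) y :> barrier_grad \<alpha> y"
    and "gradient (rpower_barrier \<alpha>) y = barrier_grad \<alpha> y"
proof -
  show *: "GDERIV (rpower_barrier \<alpha>) y :> barrier_grad \<alpha> y"
    using interior_rpower_cone[of "fst y" "snd y" \<alpha>] assms
    by (intro GDERIV_rpower_barrier) (simp_all add: slack_def)
  show "gradient (rpower_barrier \<alpha>) y = barrier_grad \<alpha> y"
    using * by (rule gradient_eqI)
qed

text \<open>
  The closed form of the gradient is valid on an open set, so it may be differentiated in place of
  the gradient itself.
\<close>

lemma hessian_rpower_barrier:
  fixes y :: "(real ^ 'm) \<times> (real ^ 'n)"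
  assumes y: "y \<in> interior (rpower_cone \<alpha>)"
  shows "(gradient (rpower_barrier \<alpha>) has_derivative barrier_hess \<alpha> y) (at y)"
    and "hessian (rpower_barrier \<alpha>) y = barrier_hess \<alpha> y"
proof -
  have "(barrier_grad \<alpha> has_derivative barrier_hess \<alpha> y) (at y)"
    using interior_rpower_cone[of "fst y" "snd y" \<alpha>] y
    by (intro has_derivative_barrier_grad) (simp_all add: slack_def)
  then show *: "(gradient (rpower_barrier \<alpha>) has_derivative barrier_hess \<alpha> y) (at y)"
    using y gradient_rpower_barrier(2)[symmetric]
    by (rule has_derivative_transform_within_open[OF _ open_interior])
  show "hessian (rpower_barrier \<alpha>) y = barrier_hess \<alpha> y"
    unfolding hessian_def using frechet_derivative_at[OF *] by simp
qed

section \<open>Inverting the Hessian\<close>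

text \<open>
  The scalar core of the inversion: \<open>c\<close> is the coefficient of \<open>u\<close> in the first component of the
  claimed preimage, \<open>s\<close> and \<open>p\<close> are the two pairings of that preimage which enter the Hessian, and
  the two conclusions are what the \<open>u\<close>- and the \<open>w\<close>-equations require. Both follow from
  \<open>t k\<^sub>1 / (2f) = X + 2ns/\<zeta>\<close> and \<open>c k\<^sub>1 = 2fs - \<zeta>X\<close>, using \<open>k\<^sub>1 = \<zeta> + 2n = 2f - \<zeta>\<close>.
\<close>

lemma reduced_hessian_system:
  fixes f n k2 X q :: real
  defines "\<zeta> \<equiv> f - n" and "k1 \<equiv> f + n"
  defines "k3 \<equiv> k1 / (2 * f) + 2 * k2 * (n / \<zeta>)"
  defines "t \<equiv> (X - 2 * n / \<zeta> * q) / k3"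
  defines "c \<equiv> 1 / k3 * ((- \<zeta> * k3 - 2 * k2 * f) / k1 * X - q)"
  defines "s \<equiv> - q - k2 * t"
  defines "p \<equiv> \<zeta> * X / 2 + n * c"
  assumes nz: "f \<noteq> 0" "\<zeta> \<noteq> 0" "k1 \<noteq> 0" "k3 \<noteq> 0"
  shows "c * \<zeta> = 2 * f * s - 2 * p" and "t * \<zeta>\<^sup>2 = 4 * f * (p - s * n)"
proof -
  have tk: "t * k3 = X - 2 * n / \<zeta> * q"
    using nz by (simp add: t_def)
  have t1: "t * k1 / (2 * f) = X + 2 * n * s / \<zeta>"
    using tk unfolding k3_def s_def by (simp add: algebra_simps diff_divide_distrib add_divide_distrib)
  then have t2: "t * k1 * \<zeta> = 2 * f * (X * \<zeta> + 2 * n * s)"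
    using nz by (simp add: field_simps)
  have "c * k1 = 2 * f * s - \<zeta> * X"
  proof -
    \<comment> \<open>\<open>m\<close> is \<open>-s k\<^sub>3\<close> with \<open>t\<close> eliminated, so \<open>-2fm\<close> in \<open>c k\<^sub>1 k\<^sub>3\<close> turns into \<open>2fs k\<^sub>3\<close>.\<close>
    define m where "m = k2 * X + q * (k1 / (2 * f))"
    have "c * k1 * k3 = - \<zeta> * k3 * X - 2 * f * m"
      using nz by (simp add: c_def m_def field_simps)
    moreover have "s * k3 = - m"
    proof -
      have "s * k3 = - q * k3 - k2 * (t * k3)" by (simp add: s_def algebra_simps)
      also have "\<dots> = - m"
        unfolding tk by (simp add: k3_def m_def algebra_simps)
      finally show ?thesis .
    qed
    ultimately have "c * k1 * k3 = (2 * f * s - \<zeta> * X) * k3"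
      by (simp add: left_diff_distrib mult.assoc)
    then show ?thesis using nz by simp
  qed
  moreover have "k1 = \<zeta> + 2 * n" by (simp add: k1_def \<zeta>_def)
  ultimately show c: "c * \<zeta> = 2 * f * s - 2 * p"
    by (simp add: p_def algebra_simps)
  have "k1 * (t * \<zeta>\<^sup>2) = 2 * f * \<zeta> * (X * \<zeta> + 2 * n * s)"
    using t2 by (simp add: power2_eq_square mult_ac)
  also have "\<dots> = k1 * (4 * f * (p - s * n))"
  proof -
    have "2 * k1 * p = \<zeta> * X * k1 + 2 * n * (c * k1)"
      by (simp add: p_def algebra_simps)
    also have "c * k1 = 2 * f * s - \<zeta> * X" by fact
    finally have "2 * k1 * p = \<zeta> * X * k1 + 2 * n * (2 * f * s - \<zeta> * X)" .
    then have "2 * k1 * (p - s * n) = \<zeta> * (X * \<zeta> + 2 * n * s)"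
      by (simp add: k1_def \<zeta>_def algebra_simps)
    moreover have "k1 * (4 * f * (p - s * n)) = 2 * f * (2 * k1 * (p - s * n))" by simp
    ultimately show ?thesis by (simp only: mult.assoc)
  qed
  finally show "t * \<zeta>\<^sup>2 = 4 * f * (p - s * n)" using nz by simp
qed

lemma weight_le_1:
  fixes \<alpha> :: "real ^ 'n"
  assumes "\<And>i. \<alpha> $ i > 0" and "(\<Sum>i\<in>UNIV. \<alpha> $ i) = 1"
  shows "\<alpha> $ i \<le> 1"
  using member_le_sum[of i UNIV "\<lambda>i. \<alpha> $ i"] assms by (simp add: less_imp_le)

lemma barrier_grad_w_neg:
  fixes y :: "(real ^ 'm) \<times> (real ^ 'n)"
  assumes "0 < \<alpha> $ i" "\<alpha> $ i \<le> 1" "snd y $ i > 0" "slack \<alpha> y > 0"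
  shows "snd (barrier_grad \<alpha> y) $ i < 0"
proof -
  have "\<phi> \<alpha> (snd y) > 0"
    using assms(4) zero_le_power2[of "norm (fst y)"] unfolding slack_def by linarith
  then have "2 * \<alpha> $ i * (\<phi> \<alpha> (snd y) / slack \<alpha> y) > 0" using assms by simp
  then show ?thesis
    using assms unfolding barrier_grad_def by (simp add: divide_neg_pos)
qed

text \<open>
  Here \<open>k2\<close> is negative, so a lower bound for it is needed. Dropping the nonnegative part
  \<open>1 - \<alpha>\<^sub>i\<close> of \<open>-w\<^sub>i g\<^sub>w\<^sub>i\<close> bounds the \<open>i\<close>-th summand of \<open>k2\<close> below by \<open>-\<alpha>\<^sub>i \<zeta>/(2f)\<close>;
  summing gives \<open>k2 \<ge> -\<zeta>/(2f)\<close>. What remains is \<open>(f + n)/(2f) - n/f = \<zeta>/(2f) > 0\<close>.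
\<close>

lemma reduced_pivot_pos:
  fixes y :: "(real ^ 'm) \<times> (real ^ 'n)"
  assumes \<alpha>: "\<And>i. \<alpha> $ i > 0" and sum1: "(\<Sum>i\<in>UNIV. \<alpha> $ i) = 1"
    and pos: "\<And>i. snd y $ i > 0" and slack: "slack \<alpha> y > 0"
  defines "f \<equiv> \<phi> \<alpha> (snd y)" and "n \<equiv> (norm (fst y))\<^sup>2"
  defines "k2 \<equiv> (\<alpha> \<oslash> snd y) \<bullet> (\<alpha> \<oslash> snd (barrier_grad \<alpha> y))"
  shows "(f + n) / (2 * f) + 2 * k2 * (n / slack \<alpha> y) > 0"
proof -
  let ?\<zeta> = "slack \<alpha> y"
  note \<alpha>1 = weight_le_1[OF \<alpha> sum1]
  have n: "n \<ge> 0" and \<zeta>: "?\<zeta> = f - n" by (simp_all add: n_def f_def slack_def)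
  then have f: "f > 0" using slack by simp
  have "- (\<alpha> $ i * (?\<zeta> / (2 * f))) \<le> (\<alpha> \<oslash> snd y) $ i * (\<alpha> \<oslash> snd (barrier_grad \<alpha> y)) $ i" for i
  proof -
    let ?d = "2 * \<alpha> $ i * (f / ?\<zeta>) + (1 - \<alpha> $ i)"
    have d: "0 < 2 * \<alpha> $ i * (f / ?\<zeta>)" "2 * \<alpha> $ i * (f / ?\<zeta>) \<le> ?d"
      using \<alpha>[of i] \<alpha>1[of i] f slack by simp_all
    have "(\<alpha> \<oslash> snd y) $ i * (\<alpha> \<oslash> snd (barrier_grad \<alpha> y)) $ i = - ((\<alpha> $ i)\<^sup>2 / ?d)"
    proof -
      have "a / v * (a / (- r / v)) = - (a\<^sup>2 / r)" if "v \<noteq> 0" for a r v :: real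
        using that by (simp add: power2_eq_square)
      then show ?thesis
        using pos[of i] by (simp only: vec_divide_def barrier_grad_def f_def vec_lambda_beta snd_conv)
    qed
    moreover have "(\<alpha> $ i)\<^sup>2 / ?d \<le> (\<alpha> $ i)\<^sup>2 / (2 * \<alpha> $ i * (f / ?\<zeta>))"
      by (rule frac_le[OF zero_le_power2 order_refl d])
    moreover have "(\<alpha> $ i)\<^sup>2 / (2 * \<alpha> $ i * (f / ?\<zeta>)) = \<alpha> $ i * (?\<zeta> / (2 * f))"
      using \<alpha>[of i] f slack by (simp add: field_simps power2_eq_square)
    ultimately show ?thesis by simp
  qed
  then have "(\<Sum>i\<in>UNIV. - (\<alpha> $ i * (?\<zeta> / (2 * f)))) \<le> k2"
    unfolding k2_def inner_vec_def by (intro sum_mono) simp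
  then have "- (?\<zeta> / (2 * f)) \<le> k2"
    by (simp only: sum_negf sum_distrib_right[symmetric] sum1 mult_1)
  then have "- (?\<zeta> / (2 * f)) * (2 * (n / ?\<zeta>)) \<le> k2 * (2 * (n / ?\<zeta>))"
    using n slack by (intro mult_right_mono) auto
  moreover have "- (?\<zeta> / (2 * f)) * (2 * (n / ?\<zeta>)) = - (n / f)"
    using slack f by (simp add: field_simps)
  moreover have "(f + n) / (2 * f) - n / f = ?\<zeta> / (2 * f)"
    using f unfolding \<zeta> by (simp add: field_simps)
  moreover have "?\<zeta> / (2 * f) > 0" using f slack by simp
  ultimately show ?thesis by (simp add: mult_ac)
qed

definition inverse_hess ::
    "real ^ 'n \<Rightarrow> (real ^ 'm) \<times> (real ^ 'n) \<Rightarrow> (real ^ 'm) \<times> (real ^ 'n) \<Rightarrow> (real ^ 'm) \<times> (real ^ 'n)"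
  where "inverse_hess \<alpha> y h =
    (let u = fst y; w = snd y; x = fst h; z = snd h;
         gw = snd (barrier_grad \<alpha> y);
         \<zeta> = slack \<alpha> y;
         k1 = \<phi> \<alpha> w + (norm u)\<^sup>2;
         k2 = (\<alpha> \<oslash> w) \<bullet> (\<alpha> \<oslash> gw);
         k3 = k1 / (2 * \<phi> \<alpha> w) + 2 * k2 * ((norm u)\<^sup>2 / \<zeta>);
         q = (\<alpha> \<oslash> gw) \<bullet> z
     in (\<chi> i. \<zeta> * x $ i / 2 +
               u $ i / k3 * ((- \<zeta> * k3 - 2 * k2 * \<phi> \<alpha> w) / k1 * (x \<bullet> u) - q),
         \<chi> i. - (w $ i * z $ i / gw $ i) -
               \<alpha> $ i / (k3 * gw $ i) * (x \<bullet> u - 2 * (norm u)\<^sup>2 / \<zeta> * q)))"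

text \<open>
  The claimed preimage has the form \<open>a = (\<zeta>/2) x + c u\<close> and
  \<open>b\<^sub>i = -w\<^sub>i z\<^sub>i / g\<^sub>w\<^sub>i - (\<alpha>\<^sub>i / g\<^sub>w\<^sub>i) t\<close>. Its pairings with \<open>u\<close> and \<open>\<alpha>/w\<close> are the numbers \<open>p\<close> and
  \<open>s\<close> of \<open>reduced_hessian_system\<close>, and the two identities proved there turn each component of the
  Hessian at \<open>(a, b)\<close> into the corresponding component of \<open>(x, z)\<close>.
\<close>

lemma barrier_hess_inverse_hess:
  fixes y h :: "(real ^ 'm) \<times> (real ^ 'n)"
  assumes \<alpha>: "\<And>i. \<alpha> $ i > 0" and sum1: "(\<Sum>i\<in>UNIV. \<alpha> $ i) = 1"
    and pos: "\<And>i. snd y $ i > 0" and slack: "slack \<alpha> y > 0"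
  shows "barrier_hess \<alpha> y (inverse_hess \<alpha> y h) = h"
proof -
  define u w x z where "u = fst y" and "w = snd y" and "x = fst h" and "z = snd h"
  define gw where "gw = snd (barrier_grad \<alpha> y)"
  define f n where "f = \<phi> \<alpha> w" and "n = (norm u)\<^sup>2"
  define k2 where "k2 = (\<alpha> \<oslash> w) \<bullet> (\<alpha> \<oslash> gw)"
  define \<zeta> k1 where "\<zeta> = f - n" and "k1 = f + n"
  define k3 where "k3 = k1 / (2 * f) + 2 * k2 * (n / \<zeta>)"
  define X q where "X = x \<bullet> u" and "q = (\<alpha> \<oslash> gw) \<bullet> z"
  define t where "t = (X - 2 * n / \<zeta> * q) / k3"
  define c where "c = 1 / k3 * ((- \<zeta> * k3 - 2 * k2 * f) / k1 * X - q)"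
  define a where "a = (\<zeta> / 2) *\<^sub>R x + c *\<^sub>R u"
  define b where "b = (\<chi> i. - (w $ i * z $ i / gw $ i) - \<alpha> $ i / gw $ i * t)"
  define p s where "p = u \<bullet> a" and "s = (\<alpha> \<oslash> w) \<bullet> b"

  have slack_eq: "slack \<alpha> y = \<zeta>"
    by (simp add: \<zeta>_def slack_def f_def n_def u_def w_def)
  have K: "inverse_hess \<alpha> y h = (a, b)"
    unfolding inverse_hess_def Let_def slack_eq u_def[symmetric] w_def[symmetric] x_def[symmetric]
      z_def[symmetric] gw_def[symmetric] f_def[symmetric] n_def[symmetric] k1_def[symmetric]
      k2_def[symmetric] k3_def[symmetric] X_def[symmetric] q_def[symmetric]
    by (simp add: a_def b_def c_def t_def vec_eq_iff)
  have w: "w $ i \<noteq> 0" for i using pos[of i] by (simp add: w_def)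
  note \<alpha>1 = weight_le_1[OF \<alpha> sum1]
  have gw: "gw $ i \<noteq> 0" for i
    using barrier_grad_w_neg[OF \<alpha> \<alpha>1 pos slack, of i] by (simp add: gw_def)
  have n0: "n \<ge> 0" by (simp add: n_def)
  have \<zeta>0: "\<zeta> > 0" using slack slack_eq by simp
  have f0: "f > 0" and k10: "k1 > 0" using n0 \<zeta>0 by (simp_all add: \<zeta>_def k1_def)
  have k30: "k3 > 0"
    using reduced_pivot_pos[OF \<alpha> sum1 pos slack]
    by (simp add: k3_def k1_def k2_def f_def n_def u_def w_def gw_def slack_eq)

  have p_eq: "p = \<zeta> * X / 2 + n * c"
    by (simp add: p_def a_def X_def n_def inner_add_right inner_commute power2_norm_eq_inner)
  have s_eq: "s = - q - k2 * t"
  proof -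
    have "s = (\<Sum>i\<in>UNIV. - (\<alpha> $ i / gw $ i * z $ i) - \<alpha> $ i / w $ i * (\<alpha> $ i / gw $ i) * t)"
      unfolding s_def inner_vec_def
      by (intro sum.cong) (use w in \<open>simp_all add: b_def vec_divide_def algebra_simps\<close>)
    then show ?thesis
      by (simp add: sum_subtractf sum_negf q_def k2_def inner_vec_def vec_divide_def sum_distrib_right)
  qed
  have reduced: "c * \<zeta> = 2 * f * s - 2 * p" "t * \<zeta>\<^sup>2 = 4 * f * (p - s * n)"
    using reduced_hessian_system[of f n k2 X q] f0 \<zeta>0 k10 k30
    unfolding p_eq s_eq c_def t_def k3_def k1_def \<zeta>_def by simp_all

  have u_comp: "(2 / \<zeta>) *\<^sub>R a - ((4 * f * s - 4 * p) / \<zeta>\<^sup>2) *\<^sub>R u = x"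
  proof -
    have "(4 * f * s - 4 * p) / \<zeta>\<^sup>2 = 2 * (c * \<zeta>) / \<zeta>\<^sup>2" by (simp add: reduced(1))
    also have "\<dots> = 2 / \<zeta> * c" using \<zeta>0 by (simp add: power2_eq_square)
    finally show ?thesis using \<zeta>0 by (simp add: a_def algebra_simps)
  qed
  have w_comp: "- (4 * \<alpha> $ i * f * (p - s * n) / \<zeta>\<^sup>2) / w $ i - gw $ i * b $ i / w $ i = z $ i" for i
  proof -
    have "4 * \<alpha> $ i * f * (p - s * n) / \<zeta>\<^sup>2 = \<alpha> $ i * (t * \<zeta>\<^sup>2) / \<zeta>\<^sup>2" by (simp add: reduced(2))
    also have "\<dots> = \<alpha> $ i * t" using \<zeta>0 by simp
    finally show ?thesis using w[of i] gw[of i] by (simp add: b_def field_simps)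
  qed
  have "barrier_hess \<alpha> y (a, b) = (x, z)"
    unfolding barrier_hess_def Let_def fst_conv snd_conv slack_eq u_def[symmetric] w_def[symmetric]
      gw_def[symmetric] p_def[symmetric] s_def[symmetric] f_def[symmetric] n_def[symmetric]
    using u_comp w_comp by (simp add: vec_eq_iff)
  then show ?thesis by (simp add: K x_def z_def)
qed


theorem proposition4p2:
  fixes \<alpha> :: "real ^ 'd2"
    and u x :: "real ^ 'd1"
    and w z :: "real ^ 'd2"
  assumes "\<And>i. \<alpha> $ i > 0"
    and "(\<Sum>i\<in>UNIV. \<alpha> $ i) = 1"
    and "(u, w) \<in> interior (rpower_cone \<alpha>)"
  shows "let f = (rpower_barrier \<alpha> :: (real ^ 'd1) \<times> (real ^ 'd2) \<Rightarrow> real);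
             g = gradient f;
             H = hessian f (u, w);
             gw = snd (g (u, w));
             \<zeta> = \<phi> \<alpha> w - (norm u)\<^sup>2;
             k1 = \<phi> \<alpha> w + (norm u)\<^sup>2;
             k2 = (\<alpha> \<oslash> w) \<bullet> (\<alpha> \<oslash> gw);
             k3 = k1 / (2 * \<phi> \<alpha> w) + 2 * k2 * ((norm u)\<^sup>2 / \<zeta>)
         in GDERIV f (u, w) :> g (u, w) \<and>
            (g has_derivative H) (at (u, w)) \<and>
            bij H \<and>
            (\<forall>i. fst (inv H (x, z)) $ i =
               \<zeta> * x $ i / 2 +
               u $ i / k3 * ((- \<zeta> * k3 - 2 * k2 * \<phi> \<alpha> w) / k1 * (x \<bullet> u) - (\<alpha> \<oslash> gw) \<bullet> z)) \<and>
            (\<forall>i. snd (inv H (x, z)) $ i =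
               - (w $ i * z $ i / gw $ i) -
               \<alpha> $ i / (k3 * gw $ i) * (x \<bullet> u - 2 * (norm u)\<^sup>2 / \<zeta> * ((\<alpha> \<oslash> gw) \<bullet> z)))"
proof -
  let ?y = "(u, w)" and ?H = "barrier_hess \<alpha> (u, w)"
  have pos: "\<And>i. snd ?y $ i > 0" and slack: "slack \<alpha> ?y > 0"
    using interior_rpower_cone[OF assms(3)] by (simp_all add: slack_def)
  note H = hessian_rpower_barrier[OF assms(3)] and G = gradient_rpower_barrier[OF assms(3)]
  have right_inv: "?H (inverse_hess \<alpha> ?y h) = h" for h
    by (rule barrier_hess_inverse_hess[OF assms(1,2) pos slack])
  have lin: "linear ?H"
    using H(1) by (rule has_derivative_linear)
  have surj: "surj ?H" by (rule surjI[of ?H "inverse_hess \<alpha> ?y", OF right_inv])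
  then have inj: "inj ?H" using linear_surjective_imp_injective[OF lin] by simp
  have inv: "inv ?H (x, z) = inverse_hess \<alpha> ?y (x, z)"
    by (rule inv_f_eq[OF inj right_inv])
  have bij: "bij ?H" using inj surj by (rule bijI)
  show ?thesis
    unfolding Let_def H(2) G(2) inv inverse_hess_def slack_def fst_conv snd_conv vec_lambda_beta
    using G(1) H(1) bij by blast
qed

end
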